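(* For any non-empty index $\mathbf{k}=(k_1,\dots,k_r)$ of positive integers, $$Z^\star(\mathbf{k})=(-1)^{\mathrm{wt}(\mathbf{k})+1}\,Z^\star\big(\overline{\mathbf{k}^\vee}\big)$$ in $\mathcal{A}^{\mathrm{cyc}}$.
   Context: The weight is $\mathrm{wt}(k_1,\dots,k_r)=k_1+\cdots+k_r$. For each prime $p$ let $\zeta_p$ be a primitive $p$-th root of unity. Set $$\mathcal{A}^{\mathrm{cyc}}=\Big(\prod_{p\text{ prime}}\mathbb{Z}[\zeta_p]/(p)\Big)\Big/\Big(\bigoplus_{p\text{ prime}}\mathbb{Z}[\zeta_p]/(p)\Big),$$ a $\mathbb{Q}$-algebra ($a\in\mathbb{Q}$ acts by its reduction mod $p$ for all but finitely many $p$). With $[m]_q=\frac{1-q^m}{1-q}$ and $$z_n^\star(\mathbf{k};q)=\sum_{n>m_1\ge\cdots\ge m_r>0}\prod_{j=1}^r\frac{q^{(k_j-1)m_j}}{[m_j]_q^{k_j}},$$ one has $z_p^\star(\mathbf{k};\zeta_p)\in\mathbb{Z}[\zeta_p]$, and $Z^\star(\mathbf{k})=\big(z_p^\star(\mathbf{k};\zeta_p)\bmod (p)\big)_p\in\mathcal{A}^{\mathrm{cyc}}$. The reverse of $\mathbf{k}$ is $\overline{\mathbf{k}}=(k_r,\ldots,k_1)$. The Hoffman dual $\mathbf{k}^\vee$ of a non-empty index: in $\mathbb{Q}\langle e_0,e_1\rangle$ put $e_k=e_0^{k-1}e_1$ and $e_{\mathbf{k}}=e_{k_1}\cdots e_{k_r}$,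 let $\tau$ be the algebra automorphism exchanging $e_0$ and $e_1$, write $e_{\mathbf{k}}=w'e_1$; then $\mathbf{k}^\vee$ is the index with $e_{\mathbf{k}^\vee}=\tau(w')e_1$. For example $(3,2)^\vee=(1,1,2,1)$. *)

theory Defs
  imports
    "HOL-Algebra.Generated_Rings"
    "HOL-Algebra.QuotRing"
    "HOL-Decision_Procs.Algebra_Aux"
    "HOL-Number_Theory.Cong"
    Complex_Main
begin

subsection \<open>Multiple harmonic \<open>q\<close>-sums\<close>

text \<open>An index is a list of positive naturals; its weight is \<^const>\<open>sum_list\<close> and its
  reverse is \<^const>\<open>rev\<close>.\<close>

definition is_index :: "nat list \<Rightarrow> bool" where
  "is_index ks \<longleftrightarrow> (\<forall>k\<in>set ks. 0 < k)"

definition q_int :: "'a::field \<Rightarrow> nat \<Rightarrow> 'a" where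
  "q_int q m = (1 - q ^ m) / (1 - q)"

text \<open>The truncated subtraction below is harmless, since the entries of an index are positive.
  The list \<open>[m\<^sub>1, \<dots>, m\<^sub>r]\<close> with \<open>n > m\<^sub>1 \<ge> \<dots> \<ge> m\<^sub>r > 0\<close> is indexed from \<open>0\<close>.\<close>

definition z_star :: "nat \<Rightarrow> nat list \<Rightarrow> 'a::field \<Rightarrow> 'a" where
  "z_star n ks q =
     (\<Sum>ms | length ms = length ks \<and> sorted_wrt (\<ge>) ms \<and> set ms \<subseteq> {0<..<n}.
        \<Prod>j<length ks. q ^ ((ks ! j - 1) * ms ! j) / q_int q (ms ! j) ^ (ks ! j))"

subsection \<open>The Hoffman dual\<close>

text \<open>Only monomials of \<open>\<rat>\<langle>e\<^sub>0, e\<^sub>1\<rangle>\<close> occur; they are words in two letters, on which the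
  automorphism \<open>\<tau>\<close> acts letter by letter.\<close>

datatype letter = E0 | E1

fun swap_letter :: "letter \<Rightarrow> letter" where
  "swap_letter E0 = E1"
| "swap_letter E1 = E0"

definition tau :: "letter list \<Rightarrow> letter list" where
  "tau w = map swap_letter w"

definition index_word :: "nat list \<Rightarrow> letter list" where
  "index_word ks = concat (map (\<lambda>k. replicate (k - 1) E0 @ [E1]) ks)"

text \<open>For non-empty \<open>ks\<close> the word of \<open>ks\<close> ends in \<^const>\<open>E1\<close>, so \<^const>\<open>butlast\<close> yields the
  prefix \<open>w'\<close> with \<open>e\<^sub>k = w' e\<^sub>1\<close>.\<close>

definition hoffman_dual :: "nat list \<Rightarrow> nat list" where
  "hoffman_dual ks =
     (THE ls. is_index ls \<and> index_word ls = tau (butlast (index_word ks)) @ [E1])"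

subsection \<open>The ring \<open>\<A>\<^sup>c\<^sup>y\<^sup>c\<close>\<close>

definition primitive_root_of_unity :: "nat \<Rightarrow> 'a::field \<Rightarrow> bool" where
  "primitive_root_of_unity n z \<longleftrightarrow> 0 < n \<and> z ^ n = 1 \<and> (\<forall>m. 0 < m \<and> m < n \<longrightarrow> z ^ m \<noteq> 1)"

text \<open>\<open>int_adjoin z\<close> is \<open>\<int>[z]\<close>, the subring of \<open>\<complex>\<close> generated by \<open>z\<close>.\<close>

definition int_adjoin :: "complex \<Rightarrow> complex ring" where
  "int_adjoin z = cring_class_ops\<lparr>carrier := generate_ring cring_class_ops {z}\<rparr>"

definition int_adjoin_mod :: "complex \<Rightarrow> nat \<Rightarrow> complex set ring" where
  "int_adjoin_mod z p = int_adjoin z Quot (PIdl\<^bsub>int_adjoin z\<^esub> (of_nat p))"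

definition product_ring :: "'i set \<Rightarrow> ('i \<Rightarrow> ('a, 'b) ring_scheme) \<Rightarrow> ('i \<Rightarrow> 'a) ring" where
  "product_ring I R =
     \<lparr>carrier = (\<Pi>\<^sub>E i\<in>I. carrier (R i)),
      monoid.mult = (\<lambda>x y. \<lambda>i\<in>I. x i \<otimes>\<^bsub>R i\<^esub> y i),
      one = (\<lambda>i\<in>I. \<one>\<^bsub>R i\<^esub>),
      ring.zero = (\<lambda>i\<in>I. \<zero>\<^bsub>R i\<^esub>),
      add = (\<lambda>x y. \<lambda>i\<in>I. x i \<oplus>\<^bsub>R i\<^esub> y i)\<rparr>"

definition direct_sum_ideal :: "'i set \<Rightarrow> ('i \<Rightarrow> ('a, 'b) ring_scheme) \<Rightarrow> ('i \<Rightarrow> 'a) set" where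
  "direct_sum_ideal I R = {x \<in> (\<Pi>\<^sub>E i\<in>I. carrier (R i)). finite {i \<in> I. x i \<noteq> \<zero>\<^bsub>R i\<^esub>}}"

text \<open>In the following, \<open>\<zeta> p\<close> is the chosen primitive \<open>p\<close>-th root of unity.\<close>

definition A_prod :: "(nat \<Rightarrow> complex) \<Rightarrow> (nat \<Rightarrow> complex set) ring" where
  "A_prod \<zeta> = product_ring {p. prime p} (\<lambda>p. int_adjoin_mod (\<zeta> p) p)"

definition A_sum :: "(nat \<Rightarrow> complex) \<Rightarrow> (nat \<Rightarrow> complex set) set" where
  "A_sum \<zeta> = direct_sum_ideal {p. prime p} (\<lambda>p. int_adjoin_mod (\<zeta> p) p)"

definition A_cyc :: "(nat \<Rightarrow> complex) \<Rightarrow> (nat \<Rightarrow> complex set) set ring" where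
  "A_cyc \<zeta> = A_prod \<zeta> Quot A_sum \<zeta>"

definition Z_star :: "(nat \<Rightarrow> complex) \<Rightarrow> nat list \<Rightarrow> (nat \<Rightarrow> complex set) set" where
  "Z_star \<zeta> ks =
     A_sum \<zeta> +>\<^bsub>A_prod \<zeta>\<^esub>
       (\<lambda>p\<in>{p. prime p}.
          PIdl\<^bsub>int_adjoin (\<zeta> p)\<^esub> (of_nat p) +>\<^bsub>int_adjoin (\<zeta> p)\<^esub> z_star p ks (\<zeta> p))"

subsection \<open>Well-definedness\<close>

lemma index_word_Cons: "index_word (k # ks) = replicate (k - 1) E0 @ E1 # index_word ks"
  by (simp add: index_word_def)

lemma replicate_E0_eq_iff:
  "replicate a E0 @ E1 # v = replicate b E0 @ E1 # w \<longleftrightarrow> a = b \<and> v = w"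
proof (induction a arbitrary: b)
  case 0
  then show ?case by (cases b) auto
next
  case (Suc a)
  then show ?case by (cases b) auto
qed

lemma index_word_inj:
  "is_index ks \<Longrightarrow> is_index ls \<Longrightarrow> index_word ks = index_word ls \<Longrightarrow> ks = ls"
proof (induction ks arbitrary: ls)
  case Nil
  then show ?case by (cases ls) (auto simp: index_word_def)
next
  case (Cons k ks)
  from Cons.prems(3) obtain l ls' where ls: "ls = l # ls'"
    by (cases ls) (auto simp: index_word_def)
  have "k - 1 = l - 1" "index_word ks = index_word ls'"
    using Cons.prems(3) by (auto simp: ls index_word_Cons replicate_E0_eq_iff)
  moreover have "0 < k" "0 < l" "is_index ks" "is_index ls'"
    using Cons.prems(1,2) by (auto simp: ls is_index_def)
  ultimately show ?case
    using Cons.IH[of ls'] by (simp add: ls)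
qed

lemma index_word_surj: "\<exists>ls. is_index ls \<and> index_word ls = w @ [E1]"
proof (induction w)
  case Nil
  show ?case by (rule exI[of _ "[1]"]) (simp add: is_index_def index_word_def)
next
  case (Cons a w)
  then obtain ls where ls: "is_index ls" "index_word ls = w @ [E1]" by blast
  show ?case
  proof (cases a)
    case E1
    with ls show ?thesis
      by (intro exI[of _ "1 # ls"]) (simp add: is_index_def index_word_Cons)
  next
    case E0
    from ls obtain k ks where k: "ls = k # ks"
      by (cases ls) (auto simp: index_word_def)
    with ls have "0 < k" by (simp add: is_index_def)
    with ls E0 k show ?thesis
      by (intro exI[of _ "Suc k # ks"]) (cases k, auto simp: is_index_def index_word_Cons)
  qed
qed

lemma hoffman_dual_spec:
  "is_index (hoffman_dual ks)"
  "index_word (hoffman_dual ks) = tau (butlast (index_word ks)) @ [E1]"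
proof -
  have "\<exists>!ls. is_index ls \<and> index_word ls = tau (butlast (index_word ks)) @ [E1]"
    using index_word_surj index_word_inj by metis
  from theI'[OF this] show "is_index (hoffman_dual ks)"
    "index_word (hoffman_dual ks) = tau (butlast (index_word ks)) @ [E1]"
    by (simp_all add: hoffman_dual_def)
qed

lemma hoffman_dual_example: "hoffman_dual [3, 2] = [1, 1, 2, 1]"
  by (rule index_word_inj)
    (simp_all add: hoffman_dual_spec, simp_all add: is_index_def index_word_def tau_def
      numeral_eq_Suc)

lemma cring_int_adjoin: "cring (int_adjoin z)"
proof -
  have "subring (generate_ring cring_class_ops {z}) (cring_class_ops :: complex ring)"
    by (rule ring.generate_ring_is_subring[OF cring.axioms(1)[OF cring_class]]) (simp add: cring_class_ops_def)
  then have "ring (int_adjoin z)"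
    unfolding int_adjoin_def by (rule ring.subring_is_ring[OF cring.axioms(1)[OF cring_class]])
  then show ?thesis
    by (intro cring.intro comm_monoid.intro ring.axioms comm_monoid_axioms.intro)
      (auto simp: int_adjoin_def cring_class_ops_def ring_def)
qed

lemma int_adjoin_simps [simp]:
  "\<one>\<^bsub>int_adjoin z\<^esub> = 1" "\<zero>\<^bsub>int_adjoin z\<^esub> = 0"
  "x \<otimes>\<^bsub>int_adjoin z\<^esub> y = x * y" "x \<oplus>\<^bsub>int_adjoin z\<^esub> y = x + y"
  by (simp_all add: int_adjoin_def cring_class_ops_def)

lemma int_adjoin_self: "z \<in> carrier (int_adjoin z)"
  by (simp add: int_adjoin_def generate_ring.incl)

lemma int_adjoin_closed:
  shows "1 \<in> carrier (int_adjoin z)" "0 \<in> carrier (int_adjoin z)"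
    and "x \<in> carrier (int_adjoin z) \<Longrightarrow> y \<in> carrier (int_adjoin z) \<Longrightarrow> x + y \<in> carrier (int_adjoin z)"
    and "x \<in> carrier (int_adjoin z) \<Longrightarrow> y \<in> carrier (int_adjoin z) \<Longrightarrow> x * y \<in> carrier (int_adjoin z)"
proof -
  interpret R: cring "int_adjoin z" by (rule cring_int_adjoin)
  show "1 \<in> carrier (int_adjoin z)" "0 \<in> carrier (int_adjoin z)"
    using R.one_closed R.zero_closed by simp_all
  show "x \<in> carrier (int_adjoin z) \<Longrightarrow> y \<in> carrier (int_adjoin z) \<Longrightarrow> x + y \<in> carrier (int_adjoin z)"
    using R.a_closed by simp
  show "x \<in> carrier (int_adjoin z) \<Longrightarrow> y \<in> carrier (int_adjoin z) \<Longrightarrow> x * y \<in> carrier (int_adjoin z)"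
    using R.m_closed by simp
qed

lemma int_adjoin_power:
  "x \<in> carrier (int_adjoin z) \<Longrightarrow> x ^ n \<in> carrier (int_adjoin z)"
  by (induction n) (auto intro: int_adjoin_closed)

lemma int_adjoin_sum:
  "(\<And>i. i \<in> S \<Longrightarrow> f i \<in> carrier (int_adjoin z)) \<Longrightarrow> sum f S \<in> carrier (int_adjoin z)"
  by (induction S rule: infinite_finite_induct) (auto intro: int_adjoin_closed)

lemma int_adjoin_prod:
  "(\<And>i. i \<in> S \<Longrightarrow> f i \<in> carrier (int_adjoin z)) \<Longrightarrow> prod f S \<in> carrier (int_adjoin z)"
  by (induction S rule: infinite_finite_induct) (auto intro: int_adjoin_closed)

lemma int_adjoin_of_nat: "of_nat n \<in> carrier (int_adjoin z)"
  by (induction n) (auto intro: int_adjoin_closed)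

lemma inverse_q_int_in_int_adjoin:
  assumes "prime p" "primitive_root_of_unity p z" "0 < m" "m < p"
  shows "1 / q_int z m \<in> carrier (int_adjoin z)"
proof -
  have zp: "z ^ p = 1" and zm: "z ^ m \<noteq> 1"
    using assms by (auto simp: primitive_root_of_unity_def)
  have "coprime m p"
    using assms by (metis coprime_commute nat_dvd_not_less prime_imp_coprime)
  then obtain n where "[m * n = 1] (mod p)"
    using cong_solve_coprime_nat by auto
  then have "(m * n) mod p = 1 mod p" by (simp add: cong_def)
  then have mod: "(m * n) mod p = 1" using prime_gt_1_nat[OF assms(1)] by simp
  have "z ^ (m * n) = z ^ (p * (m * n div p) + m * n mod p)" by simp
  also have "\<dots> = z"
    by (simp only: mod power_add power_mult zp) simp
  finally have "(z ^ m) ^ n = z" by (simp add: power_mult)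
  then have "1 / q_int z m = (1 - (z ^ m) ^ n) / (1 - z ^ m)"
    by (simp add: q_int_def)
  also have "\<dots> = (\<Sum>i<n. (z ^ m) ^ i)"
    using zm by (simp add: sum_gp_strict)
  also have "\<dots> \<in> carrier (int_adjoin z)"
    by (intro int_adjoin_sum int_adjoin_power int_adjoin_self)
  finally show ?thesis .
qed

lemma z_star_in_int_adjoin:
  assumes "prime p" "primitive_root_of_unity p z"
  shows "z_star p ks z \<in> carrier (int_adjoin z)"
  unfolding z_star_def
proof (intro int_adjoin_sum int_adjoin_prod)
  fix ms j
  assume ms: "ms \<in> {ms. length ms = length ks \<and> sorted_wrt (\<ge>) ms \<and> set ms \<subseteq> {0<..<p}}"
    and j: "j \<in> {..<length ks}"
  then have "ms ! j \<in> set ms" "set ms \<subseteq> {0<..<p}" by auto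
  then have "ms ! j \<in> {0<..<p}" by blast
  then have "1 / q_int z (ms ! j) \<in> carrier (int_adjoin z)"
    using inverse_q_int_in_int_adjoin[OF assms] by simp
  then have "z ^ ((ks ! j - 1) * ms ! j) * (1 / q_int z (ms ! j)) ^ (ks ! j)
    \<in> carrier (int_adjoin z)"
    by (intro int_adjoin_closed int_adjoin_power int_adjoin_self)
  then show "z ^ ((ks ! j - 1) * ms ! j) / q_int z (ms ! j) ^ (ks ! j)
    \<in> carrier (int_adjoin z)"
    by (simp add: power_one_over)
qed

lemma ideal_int_adjoin: "ideal (PIdl\<^bsub>int_adjoin z\<^esub> (of_nat p)) (int_adjoin z)"
  using cring.cgenideal_ideal[OF cring_int_adjoin] int_adjoin_of_nat by blast

lemma cring_int_adjoin_mod: "cring (int_adjoin_mod z p)"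
  unfolding int_adjoin_mod_def
  by (rule ideal.quotient_is_cring[OF ideal_int_adjoin cring_int_adjoin])

lemma product_ring_simps:
  "carrier (product_ring I R) = (\<Pi>\<^sub>E i\<in>I. carrier (R i))"
  "x \<otimes>\<^bsub>product_ring I R\<^esub> y = (\<lambda>i\<in>I. x i \<otimes>\<^bsub>R i\<^esub> y i)"
  "\<one>\<^bsub>product_ring I R\<^esub> = (\<lambda>i\<in>I. \<one>\<^bsub>R i\<^esub>)"
  "\<zero>\<^bsub>product_ring I R\<^esub> = (\<lambda>i\<in>I. \<zero>\<^bsub>R i\<^esub>)"
  "x \<oplus>\<^bsub>product_ring I R\<^esub> y = (\<lambda>i\<in>I. x i \<oplus>\<^bsub>R i\<^esub> y i)"
  by (simp_all add: product_ring_def)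

lemma cring_product_ring:
  assumes "\<And>i. i \<in> I \<Longrightarrow> cring (R i)"
  shows "cring (product_ring I R)"
proof -
  have r: "ring (R i)" if "i \<in> I" for i using assms[OF that] by (rule cring.axioms(1))
  have eq: "x = y" if "x \<in> extensional I" "y \<in> extensional I" "\<And>i. i \<in> I \<Longrightarrow> x i = y i"
    for x y :: "'a \<Rightarrow> 'b"
    using that by (rule extensionalityI)
  have mem: "x i \<in> carrier (R i)" if "x \<in> carrier (product_ring I R)" "i \<in> I" for x i
    using that by (auto simp: product_ring_simps)
  have ext: "x \<in> extensional I" if "x \<in> carrier (product_ring I R)" for x
    using that by (auto simp: product_ring_simps PiE_def)
  have ag: "abelian_group (product_ring I R)"
  proof (rule abelian_groupI)
    fix x y assume "x \<in> carrier (product_ring I R)" "y \<in> carrier (product_ring I R)"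
    then show "x \<oplus>\<^bsub>product_ring I R\<^esub> y \<in> carrier (product_ring I R)"
      using mem by (auto simp: product_ring_simps(1,5) intro!: ring.ring_simprules(1)[OF r])
  next
    show "\<zero>\<^bsub>product_ring I R\<^esub> \<in> carrier (product_ring I R)"
      by (auto simp: product_ring_simps(1,4) intro!: ring.ring_simprules(2)[OF r])
  next
    fix x y z
    assume "x \<in> carrier (product_ring I R)" "y \<in> carrier (product_ring I R)"
      "z \<in> carrier (product_ring I R)"
    note m = this[THEN mem]
    show "(x \<oplus>\<^bsub>product_ring I R\<^esub> y) \<oplus>\<^bsub>product_ring I R\<^esub> z
        = x \<oplus>\<^bsub>product_ring I R\<^esub> (y \<oplus>\<^bsub>product_ring I R\<^esub> z)"
      by (simp add: product_ring_simps, rule eq)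
        (simp_all add: m ring.ring_simprules(7)[OF r])
  next
    fix x y
    assume "x \<in> carrier (product_ring I R)" "y \<in> carrier (product_ring I R)"
    note m = this[THEN mem]
    show "x \<oplus>\<^bsub>product_ring I R\<^esub> y = y \<oplus>\<^bsub>product_ring I R\<^esub> x"
      by (simp only: product_ring_simps, rule eq)
        (use m ring.ring_simprules(10)[OF r] in \<open>simp_all\<close>)
  next
    fix x assume x: "x \<in> carrier (product_ring I R)"
    note m = x[THEN mem] and e = x[THEN ext]
    show "\<zero>\<^bsub>product_ring I R\<^esub> \<oplus>\<^bsub>product_ring I R\<^esub> x = x"
      by (simp only: product_ring_simps, rule eq)
        (simp_all add: e m ring.ring_simprules(8)[OF r])
    have "(\<lambda>i\<in>I. \<ominus>\<^bsub>R i\<^esub> x i) \<in> carrier (product_ring I R)"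
      using m by (auto simp: product_ring_simps(1) intro!: ring.ring_simprules(3)[OF r])
    moreover have "(\<lambda>i\<in>I. \<ominus>\<^bsub>R i\<^esub> x i) \<oplus>\<^bsub>product_ring I R\<^esub> x = \<zero>\<^bsub>product_ring I R\<^esub>"
      by (simp only: product_ring_simps, rule eq)
        (simp_all add: m ring.ring_simprules(9)[OF r])
    ultimately show "\<exists>y\<in>carrier (product_ring I R).
        y \<oplus>\<^bsub>product_ring I R\<^esub> x = \<zero>\<^bsub>product_ring I R\<^esub>"
      by blast
  qed
  have cm: "Group.comm_monoid (product_ring I R)"
  proof (rule comm_monoidI)
    fix x y assume "x \<in> carrier (product_ring I R)" "y \<in> carrier (product_ring I R)"
    then show "x \<otimes>\<^bsub>product_ring I R\<^esub> y \<in> carrier (product_ring I R)"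
      using mem by (auto simp: product_ring_simps(1,2) intro!: ring.ring_simprules(5)[OF r])
  next
    show "\<one>\<^bsub>product_ring I R\<^esub> \<in> carrier (product_ring I R)"
      by (auto simp: product_ring_simps(1,3) intro!: ring.ring_simprules(6)[OF r])
  next
    fix x y z
    assume "x \<in> carrier (product_ring I R)" "y \<in> carrier (product_ring I R)"
      "z \<in> carrier (product_ring I R)"
    note m = this[THEN mem]
    show "(x \<otimes>\<^bsub>product_ring I R\<^esub> y) \<otimes>\<^bsub>product_ring I R\<^esub> z
        = x \<otimes>\<^bsub>product_ring I R\<^esub> (y \<otimes>\<^bsub>product_ring I R\<^esub> z)"
      by (simp add: product_ring_simps, rule eq)
        (simp_all add: m ring.ring_simprules(11)[OF r])
  next
    fix x assume x: "x \<in> carrier (product_ring I R)"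
    note m = x[THEN mem] and e = x[THEN ext]
    show "\<one>\<^bsub>product_ring I R\<^esub> \<otimes>\<^bsub>product_ring I R\<^esub> x = x"
      by (simp only: product_ring_simps, rule eq)
        (simp_all add: e m ring.ring_simprules(12)[OF r])
  next
    fix x y
    assume "x \<in> carrier (product_ring I R)" "y \<in> carrier (product_ring I R)"
    note m = this[THEN mem]
    show "x \<otimes>\<^bsub>product_ring I R\<^esub> y = y \<otimes>\<^bsub>product_ring I R\<^esub> x"
      by (simp only: product_ring_simps, rule eq)
        (use m cring.cring_simprules(14)[OF assms] in \<open>simp_all\<close>)
  qed
  show ?thesis
  proof (rule cringI[OF ag cm])
    fix x y z
    assume "x \<in> carrier (product_ring I R)" "y \<in> carrier (product_ring I R)"
      "z \<in> carrier (product_ring I R)"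
    note m = this[THEN mem]
    show "(x \<oplus>\<^bsub>product_ring I R\<^esub> y) \<otimes>\<^bsub>product_ring I R\<^esub> z
        = x \<otimes>\<^bsub>product_ring I R\<^esub> z \<oplus>\<^bsub>product_ring I R\<^esub> y \<otimes>\<^bsub>product_ring I R\<^esub> z"
      by (simp only: product_ring_simps, rule eq)
        (use m ring.ring_simprules(13)[OF r] in \<open>simp_all\<close>)
  qed
qed

lemma ideal_direct_sum_ideal:
  assumes "\<And>i. i \<in> I \<Longrightarrow> cring (R i)"
  shows "ideal (direct_sum_ideal I R) (product_ring I R)"
proof -
  interpret P: cring "product_ring I R" by (rule cring_product_ring[OF assms])
  have r: "ring (R i)" if "i \<in> I" for i using assms[OF that] by (rule cring.axioms(1))
  have mem_iff: "x \<in> direct_sum_ideal I R \<longleftrightarrow>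
    x \<in> carrier (product_ring I R) \<and> finite {i \<in> I. x i \<noteq> \<zero>\<^bsub>R i\<^esub>}" for x
    by (simp add: direct_sum_ideal_def product_ring_simps)
  have sub: "direct_sum_ideal I R \<subseteq> carrier (product_ring I R)"
    by (auto simp: direct_sum_ideal_def product_ring_def)
  have mult: "x \<otimes>\<^bsub>product_ring I R\<^esub> a \<in> direct_sum_ideal I R"
    if a: "a \<in> direct_sum_ideal I R" and x: "x \<in> carrier (product_ring I R)" for a x
  proof -
    have xi: "x i \<in> carrier (R i)" if "i \<in> I" for i
      using x that by (auto simp: product_ring_def)
    have "{i \<in> I. (x \<otimes>\<^bsub>product_ring I R\<^esub> a) i \<noteq> \<zero>\<^bsub>R i\<^esub>} \<subseteq> {i \<in> I. a i \<noteq> \<zero>\<^bsub>R i\<^esub>}"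
      using xi by (auto simp: product_ring_def ring.ring_simprules(25)[OF r])
    moreover have "x \<otimes>\<^bsub>product_ring I R\<^esub> a \<in> carrier (product_ring I R)"
      using a sub x by blast
    ultimately show ?thesis
      using a mem_iff finite_subset by blast
  qed
  have add: "x \<oplus>\<^bsub>product_ring I R\<^esub> y \<in> direct_sum_ideal I R"
    if x: "x \<in> direct_sum_ideal I R" and y: "y \<in> direct_sum_ideal I R" for x y
  proof -
    have "{i \<in> I. (x \<oplus>\<^bsub>product_ring I R\<^esub> y) i \<noteq> \<zero>\<^bsub>R i\<^esub>}
      \<subseteq> {i \<in> I. x i \<noteq> \<zero>\<^bsub>R i\<^esub>} \<union> {i \<in> I. y i \<noteq> \<zero>\<^bsub>R i\<^esub>}"
      by (auto simp: product_ring_simps ring.ring_simprules(2,8)[OF r])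
    moreover have "x \<oplus>\<^bsub>product_ring I R\<^esub> y \<in> carrier (product_ring I R)"
      using x y sub by blast
    ultimately show ?thesis
      using x y mem_iff finite_subset finite_UnI by meson
  qed
  have zero: "\<zero>\<^bsub>product_ring I R\<^esub> \<in> direct_sum_ideal I R"
    unfolding mem_iff using P.zero_closed by (simp add: product_ring_simps)
  have neg: "\<ominus>\<^bsub>product_ring I R\<^esub> x \<in> direct_sum_ideal I R" if x: "x \<in> direct_sum_ideal I R" for x
  proof -
    have "\<ominus>\<^bsub>product_ring I R\<^esub> x = (\<ominus>\<^bsub>product_ring I R\<^esub> \<one>\<^bsub>product_ring I R\<^esub>) \<otimes>\<^bsub>product_ring I R\<^esub> x"
      using x sub P.l_minus[OF P.one_closed, of x] P.l_one[of x] by (simp add: subset_iff)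
    then show ?thesis
      using mult[OF x P.a_inv_closed[OF P.one_closed]] by simp
  qed
  show ?thesis
  proof (rule idealI)
    show "ring (product_ring I R)" by (rule P.ring_axioms)
    show "subgroup (direct_sum_ideal I R) (add_monoid (product_ring I R))"
      using sub add zero neg
      by (intro subgroup.intro) (auto simp: a_inv_def)
    show "x \<otimes>\<^bsub>product_ring I R\<^esub> a \<in> direct_sum_ideal I R"
      if "a \<in> direct_sum_ideal I R" "x \<in> carrier (product_ring I R)" for a x
      using mult that .
    then show "a \<otimes>\<^bsub>product_ring I R\<^esub> x \<in> direct_sum_ideal I R"
      if "a \<in> direct_sum_ideal I R" "x \<in> carrier (product_ring I R)" for a x
      using that sub P.m_comm[of a x] by auto
  qed
qed

lemma cring_A_cyc: "cring (A_cyc \<zeta>)"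
  unfolding A_cyc_def A_prod_def A_sum_def
  by (intro ideal.quotient_is_cring ideal_direct_sum_ideal cring_product_ring cring_int_adjoin_mod)

lemma coset_in_FactRing: "x \<in> carrier R \<Longrightarrow> I +>\<^bsub>R\<^esub> x \<in> carrier (R Quot I)"
  by (auto simp: FactRing_simps)

lemma Z_star_in_carrier:
  assumes "\<And>p. prime p \<Longrightarrow> primitive_root_of_unity p (\<zeta> p)"
  shows "Z_star \<zeta> ks \<in> carrier (A_cyc \<zeta>)"
proof -
  have "PIdl\<^bsub>int_adjoin (\<zeta> p)\<^esub> (of_nat p) +>\<^bsub>int_adjoin (\<zeta> p)\<^esub> z_star p ks (\<zeta> p)
    \<in> carrier (int_adjoin_mod (\<zeta> p) p)" if "prime p" for p
    unfolding int_adjoin_mod_def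
    by (intro coset_in_FactRing z_star_in_int_adjoin that assms)
  then have "(\<lambda>p\<in>{p. prime p}.
      PIdl\<^bsub>int_adjoin (\<zeta> p)\<^esub> (of_nat p) +>\<^bsub>int_adjoin (\<zeta> p)\<^esub> z_star p ks (\<zeta> p))
    \<in> carrier (A_prod \<zeta>)"
    unfolding A_prod_def product_ring_simps by (intro restrict_PiE_iff[THEN iffD2]) simp
  then show ?thesis
    unfolding Z_star_def A_cyc_def by (rule coset_in_FactRing)
qed

end

theory Submission
  imports Defs
begin

text \<open>
  The identity already holds in \<open>\<complex>\<close>, for every single prime: if \<open>q\<close> is a primitive
  \<open>n\<close>-th root of unity, then
  \<open>z_star n ks q = (-1) ^ (wt ks + 1) * z_star n (rev (hoffman_dual ks)) q\<close>
  (\<open>z_star_duality\<close>). The theorem follows by reading this coordinatewise.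

  Both sides are built one letter at a time from the words of the two indices. Consider functions
  on \<open>{1, \<dots>, n - 1}\<close>. On the left, \<open>e\<^sub>0\<close> multiplies by \<open>q\<^sup>m / [m]\<close>, and \<open>e\<^sub>1\<close> takes the sum over
  \<open>{1, \<dots>, m}\<close> and multiplies by \<open>1 / [m]\<close>. On the right, reversing the index reverses the
  direction of the inequalities, and the substitution \<open>m \<mapsto> n - m\<close> restores it. At a root of unity
  \<open>q\<^sup>n\<^sup>-\<^sup>m / [n - m] = - 1 / [m]\<close> and \<open>1 / [n - m] = - q\<^sup>m / [m]\<close>, so this substitution also
  exchanges the two weights, at the price of one sign per letter. On the right, therefore, \<open>e\<^sub>0\<close>
  multiplies by \<open>1 / [m]\<close>, while \<open>e\<^sub>1\<close> sums and multiplies by \<open>q\<^sup>m / [m]\<close>.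

  What remains is a statement about two pairs of operators: multiplication by \<open>q\<^sup>m / [m]\<close> should
  correspond to summation followed by \<open>q\<^sup>m / [m]\<close>, and summation followed by \<open>1 / [m]\<close> to
  multiplication by \<open>1 / [m]\<close>. Both correspondences are realised by one triangular matrix, the
  \<open>q\<close>-analogue of the signed binomial matrix \<open>(-1)\<^sup>k\<^sup>-\<^sup>1 binom(m-1, k-1)\<close>; they are
  \<open>sum_kernel_right\<close> and \<open>sum_kernel_left\<close>, and hold for generic \<open>q\<close>. By induction on the
  word, the matrix carries one nested sum into the other (\<open>word_sum_dual\<close>). Finally, at a root of
  unity each column of the matrix sums to \<open>-1\<close> (\<open>sum_kernel_root_of_unity\<close>); this is the
  additional sign in \<open>(-1) ^ (wt ks + 1)\<close>.
\<close>

section \<open>Nested sums over weakly decreasing sequences\<close>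

definition weak_chains :: "nat \<Rightarrow> nat \<Rightarrow> nat list set" where
  "weak_chains n r = {ms. length ms = r \<and> sorted_wrt (\<ge>) ms \<and> set ms \<subseteq> {0<..<n}}"

lemma chains_0 [simp]: "weak_chains n 0 = {[]}"
  by (auto simp: weak_chains_def)

lemma Cons_in_weak_chains_iff:
  "m # ms \<in> weak_chains n (Suc r) \<longleftrightarrow> m \<in> {0<..<n} \<and> ms \<in> weak_chains (Suc m) r"
  by (fastforce simp: weak_chains_def less_Suc_eq_le)

lemma finite_weak_chains: "finite (weak_chains n r)"
proof (rule finite_subset)
  show "weak_chains n r \<subseteq> {ms. set ms \<subseteq> {0<..<n} \<and> length ms = r}"
    by (auto simp: weak_chains_def)
qed (simp add: finite_lists_length_eq)

lemma sum_weak_chains_Suc: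
  "(\<Sum>ms\<in>weak_chains n (Suc r). f ms) = (\<Sum>m\<in>{0<..<n}. \<Sum>ms\<in>weak_chains (Suc m) r. f (m # ms))"
proof -
  have "(\<Sum>ms\<in>weak_chains n (Suc r). f ms)
      = (\<Sum>(m, ms)\<in>(SIGMA m:{0<..<n}. weak_chains (Suc m) r). f (m # ms))"
  proof (rule sum.reindex_bij_witness[where i = "\<lambda>(m, ms). m # ms" and j = "\<lambda>ms. (hd ms, tl ms)"])
    fix ms assume "ms \<in> weak_chains n (Suc r)"
    moreover from this obtain m ms' where "ms = m # ms'"
      by (cases ms) (auto simp: weak_chains_def)
    ultimately show "(\<lambda>(m, ms). m # ms) (hd ms, tl ms) = ms"
      "(hd ms, tl ms) \<in> (SIGMA m:{0<..<n}. weak_chains (Suc m) r)"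
      "(case (hd ms, tl ms) of (m, ms) \<Rightarrow> f (m # ms)) = f ms"
      by (auto simp: Cons_in_weak_chains_iff)
  qed (auto simp: Cons_in_weak_chains_iff)
  then show ?thesis
    by (simp add: sum.Sigma finite_weak_chains)
qed

text \<open>The part of a nested sum whose outermost variable equals \<open>m\<close>, read off from the word: \<open>a\<close> is
  the weight of \<^const>\<open>E0\<close> and \<open>b\<close> that of \<^const>\<open>E1\<close>. The empty word gets the unit mass at \<open>1\<close>,
  whose partial sums are constantly \<open>1\<close>, so that the innermost \<^const>\<open>E1\<close> follows the same rule
  as the others.\<close>

fun word_sum :: "(nat \<Rightarrow> 'a::field) \<Rightarrow> (nat \<Rightarrow> 'a) \<Rightarrow> letter list \<Rightarrow> nat \<Rightarrow> 'a" where
  "word_sum a b [] m = of_bool (m = 1)"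
| "word_sum a b (E0 # w) m = a m * word_sum a b w m"
| "word_sum a b (E1 # w) m = b m * (\<Sum>m'\<in>{0<..<Suc m}. word_sum a b w m')"

lemma word_sum_replicate_E0:
  "word_sum a b (replicate i E0 @ w) m = a m ^ i * word_sum a b w m"
  by (induction i) (simp_all add: mult.assoc)

text \<open>Each entry \<open>k\<close> of the index is the block \<open>e\<^sub>0\<^sup>k\<^sup>-\<^sup>1 e\<^sub>1\<close> of the word, which contributes
  \<open>a\<^sup>k\<^sup>-\<^sup>1 b\<close>; its letter \<^const>\<open>E1\<close> opens the summation over the next variable.\<close>

lemma sum_weak_chains_eq_word_sum:
  assumes "1 < n"
  shows "(\<Sum>ms\<in>weak_chains n (length ks). \<Prod>j<length ks. a (ms ! j) ^ (ks ! j - 1) * b (ms ! j))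
    = (\<Sum>m\<in>{0<..<n}. word_sum a b (index_word ks) m)"
  using assms
proof (induction ks arbitrary: n)
  case Nil
  have "(\<Sum>m\<in>{0<..<n}. of_bool (m = 1)) = (1 :: 'a)"
    using Nil by (subst sum.remove[of _ 1]) auto
  then show ?case by (simp add: index_word_def)
next
  case (Cons k ks)
  show ?case
    by (simp add: sum_weak_chains_Suc prod.lessThan_Suc_shift index_word_Cons word_sum_replicate_E0
        flip: sum_distrib_left Cons.IH del: prod.lessThan_Suc sum.lessThan_Suc)
      (simp add: mult.assoc)
qed

lemma nth_weak_chains: "ms \<in> weak_chains n r \<Longrightarrow> j < r \<Longrightarrow> ms ! j \<in> {0<..<n}"
  by (auto simp: weak_chains_def subset_iff)

lemma reflect_weak_chains:
  assumes "ms \<in> weak_chains n r"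
  shows "rev (map (\<lambda>m. n - m) ms) \<in> weak_chains n r"
    and "rev (map (\<lambda>m. n - m) (rev (map (\<lambda>m. n - m) ms))) = ms"
proof -
  have "sorted_wrt (\<lambda>x y. n - x \<le> n - y) ms"
    using assms by (auto simp: weak_chains_def elim: sorted_wrt_mono_rel[rotated])
  then show "rev (map (\<lambda>m. n - m) ms) \<in> weak_chains n r"
    using assms by (auto simp: weak_chains_def sorted_wrt_rev sorted_wrt_map)
  show "rev (map (\<lambda>m. n - m) (rev (map (\<lambda>m. n - m) ms))) = ms"
    using assms by (auto simp: weak_chains_def rev_map intro!: map_idI)
qed

text \<open>Reversing a sequence while replacing each \<open>m\<close> by \<open>n - m\<close> is an involution of the weakly
  decreasing sequences in \<open>{1, \<dots>, n - 1}\<close>.\<close>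

lemma sum_weak_chains_rev:
  "(\<Sum>ms\<in>weak_chains n (length ks). \<Prod>j<length ks. u (rev ks ! j) (ms ! j))
    = (\<Sum>ms\<in>weak_chains n (length ks). \<Prod>j<length ks. u (ks ! j) (n - ms ! j))"
proof (rule sum.reindex_bij_witness[where i = "\<lambda>ms. rev (map (\<lambda>m. n - m) ms)"
      and j = "\<lambda>ms. rev (map (\<lambda>m. n - m) ms)"])
  fix ms assume ms: "ms \<in> weak_chains n (length ks)"
  then have len: "length ms = length ks" and le: "\<And>j. j < length ks \<Longrightarrow> ms ! j < n"
    using nth_weak_chains[OF ms] by (auto simp: weak_chains_def)
  have "(\<Prod>j<length ks. u (rev ks ! j) (ms ! j))
      = (\<Prod>j<length ks. u (rev ks ! (length ks - Suc j)) (ms ! (length ks - Suc j)))"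
    by (rule prod.nat_diff_reindex[symmetric])
  also have "\<dots> = (\<Prod>j<length ks. u (ks ! j) (n - rev (map (\<lambda>m. n - m) ms) ! j))"
    using len le[THEN less_imp_le] by (intro prod.cong) (auto simp: rev_nth)
  finally show "(\<Prod>j<length ks. u (ks ! j) (n - rev (map (\<lambda>m. n - m) ms) ! j))
      = (\<Prod>j<length ks. u (rev ks ! j) (ms ! j))" ..
qed (auto simp: reflect_weak_chains)

lemma nth_index_pos: "is_index ks \<Longrightarrow> j < length ks \<Longrightarrow> 0 < ks ! j"
  by (simp add: is_index_def)

lemma z_star_eq_word_sum:
  assumes "1 < n" "is_index ks"
  shows "z_star n ks q
    = (\<Sum>m\<in>{0<..<n}. word_sum (\<lambda>m. q ^ m / q_int q m) (\<lambda>m. 1 / q_int q m) (index_word ks) m)"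
proof -
  have "q ^ ((k - 1) * m) / q_int q m ^ k = (q ^ m / q_int q m) ^ (k - 1) * (1 / q_int q m)"
    if "0 < k" for k m
    using that by (cases k) (simp_all add: power_divide mult.commute flip: power_mult)
  then show ?thesis
    unfolding z_star_def sum_weak_chains_eq_word_sum[OF assms(1), symmetric]
    using nth_index_pos[OF assms(2)] by (auto simp: weak_chains_def intro!: sum.cong prod.cong)
qed

section \<open>Reflection at a root of unity\<close>

lemma primitive_root_nz: "primitive_root_of_unity n q \<Longrightarrow> q \<noteq> 0"
  by (auto simp: primitive_root_of_unity_def power_0_left)

lemma primitive_root_power_diff:
  assumes "primitive_root_of_unity n q" "m \<le> n"
  shows "q ^ (n - m) = 1 / q ^ m"
  using assms primitive_root_nz[OF assms(1)]
  by (simp add: power_diff primitive_root_of_unity_def)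

lemma q_int_reflect:
  assumes "primitive_root_of_unity n q" "m \<le> n"
  shows "q_int q (n - m) = - (q_int q m / q ^ m)"
  using primitive_root_nz[OF assms(1)]
  by (simp add: q_int_def primitive_root_power_diff[OF assms] field_simps)
    (simp add: minus_divide_left)

text \<open>The reflection \<open>m \<mapsto> n - m\<close> undoes the reversal of the index. By \<open>q_int_reflect\<close> it changes
  the weight \<open>q\<^sup>(\<^sup>k\<^sup>-\<^sup>1\<^sup>)\<^sup>m / [m]\<^sup>k\<close> into \<open>(-1)\<^sup>k q\<^sup>m / [m]\<^sup>k\<close>, which is the same as exchanging the
  weights of the two letters and collecting one sign for each letter.\<close>

lemma z_star_rev_eq_word_sum:
  assumes q: "primitive_root_of_unity n q" and "1 < n" and ks: "is_index ks"
  shows "z_star n (rev ks) q = (- 1) ^ sum_list ks *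
    (\<Sum>m\<in>{0<..<n}. word_sum (\<lambda>m. 1 / q_int q m) (\<lambda>m. q ^ m / q_int q m) (index_word ks) m)"
proof -
  have weight: "q ^ ((k - 1) * (n - m)) / q_int q (n - m) ^ k
      = (- 1) ^ k * ((1 / q_int q m) ^ (k - 1) * (q ^ m / q_int q m))"
    if "0 < k" "m < n" for k m
  proof -
    have "q ^ ((k - 1) * (n - m)) = (1 / q ^ m) ^ (k - 1)"
      using that primitive_root_power_diff[OF q, of m]
      by (metis less_imp_le mult.commute power_mult)
    moreover have "q_int q (n - m) ^ k = (- 1) ^ k * (q_int q m / q ^ m) ^ k"
      using that power_minus[of "q_int q m / q ^ m" k] by (simp add: q_int_reflect[OF q])
    moreover have "x / ((- 1) ^ k * y) = (- 1) ^ k * (x / y)" for x y :: 'a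
      by (cases "even k") simp_all
    moreover have "(1 / q ^ m) ^ (k - 1) / (q_int q m / q ^ m) ^ k
        = (1 / q_int q m) ^ (k - 1) * (q ^ m / q_int q m)"
      using that primitive_root_nz[OF q]
      by (cases k) (simp_all add: power_divide)
    ultimately show ?thesis by (simp only:)
  qed
  have sgn: "(\<Prod>j<length ks. (- 1) ^ (ks ! j)) = ((- 1) ^ sum_list ks :: 'a)"
    by (simp add: power_sum sum_list_sum_nth atLeast0LessThan)
  have "z_star n (rev ks) q = (\<Sum>ms\<in>weak_chains n (length ks). \<Prod>j<length ks.
      q ^ ((ks ! j - 1) * (n - ms ! j)) / q_int q (n - ms ! j) ^ (ks ! j))"
    using sum_weak_chains_rev[where u = "\<lambda>k m. q ^ ((k - 1) * m) / q_int q m ^ k"]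
    by (simp add: z_star_def weak_chains_def)
  also have "\<dots> = (\<Sum>ms\<in>weak_chains n (length ks). \<Prod>j<length ks. (- 1) ^ (ks ! j) *
      ((1 / q_int q (ms ! j)) ^ (ks ! j - 1) * (q ^ (ms ! j) / q_int q (ms ! j))))"
  proof (intro sum.cong prod.cong refl weight)
    fix ms j assume "ms \<in> weak_chains n (length ks)" "j \<in> {..<length ks}"
    then show "0 < ks ! j" "ms ! j < n"
      using nth_index_pos[OF ks] nth_weak_chains by auto
  qed
  also have "\<dots> = (- 1) ^ sum_list ks * (\<Sum>m\<in>{0<..<n}.
      word_sum (\<lambda>m. 1 / q_int q m) (\<lambda>m. q ^ m / q_int q m) (index_word ks) m)"
    by (simp only: sum_weak_chains_eq_word_sum[OF \<open>1 < n\<close>, symmetric] sum_distrib_left prod.distrib sgn)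
  finally show ?thesis .
qed

section \<open>The \<open>q\<close>-binomial kernel\<close>

text \<open>Up to the factor \<open>(-1)\<^sup>n\<^sup>-\<^sup>1\<close> and a power of \<open>q\<close>, this is the Gaussian binomial coefficient of
  \<open>m - 1\<close> over \<open>n - 1\<close>: the numerator \<open>1 - q\<^sup>i\<^sup>-\<^sup>m\<close> equals \<open>- q\<^sup>i\<^sup>-\<^sup>m (1 - q\<^sup>m\<^sup>-\<^sup>i)\<close>. The form chosen
  avoids subtraction of exponents, so the recurrences below need no case distinction on the
  order of \<open>m\<close> and \<open>n\<close>.\<close>

definition q_kernel :: "'a::field \<Rightarrow> nat \<Rightarrow> nat \<Rightarrow> 'a" where
  "q_kernel q m n = (\<Prod>i\<in>{0<..<n}. (1 - q ^ i / q ^ m) / (1 - q ^ i)) / q ^ m"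

lemma kernel_1 [simp]: "q_kernel q m (Suc 0) = 1 / q ^ m"
proof -
  have "{0<..<Suc 0} = {}" by auto
  then show ?thesis by (simp add: q_kernel_def)
qed

lemma kernel_Suc:
  assumes "0 < n"
  shows "q_kernel q m (Suc n) = q_kernel q m n * ((1 - q ^ n / q ^ m) / (1 - q ^ n))"
proof -
  have "{0<..<Suc n} = insert n {0<..<n}"
    using assms by auto
  then show ?thesis by (simp add: q_kernel_def mult.commute)
qed

lemma kernel_eq_0:
  assumes "q \<noteq> 0" "0 < m" "m < n"
  shows "q_kernel q m n = 0"
proof -
  have "(\<Prod>i\<in>{0<..<n}. (1 - q ^ i / q ^ m) / (1 - q ^ i)) = 0"
    by (rule prod_zero) (use assms in \<open>auto intro!: bexI[of _ m]\<close>)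
  then show ?thesis
    by (simp add: q_kernel_def)
qed

lemma kernel_step_left:
  assumes "q \<noteq> 0" "0 < n" "\<And>i. 0 < i \<Longrightarrow> i < n \<Longrightarrow> q ^ i \<noteq> 1"
  shows "q_kernel q (Suc m) n * (q ^ n - q ^ Suc m) = q_kernel q m n * (1 - q ^ m)"
  using assms(2,3)
proof (induction n rule: nat_induct_non_zero)
  case 1
  then show ?case using \<open>q \<noteq> 0\<close> by (simp add: field_simps)
next
  case (Suc n)
  have n: "1 - q ^ n \<noteq> 0" using Suc.prems[of n] Suc.hyps by simp
  have "q_kernel q (Suc m) (Suc n) * (q ^ Suc n - q ^ Suc m)
      = q_kernel q (Suc m) n * (q ^ n - q ^ Suc m) * ((1 - q ^ n / q ^ m) / (1 - q ^ n))"
    using n \<open>q \<noteq> 0\<close> by (simp add: kernel_Suc[OF Suc.hyps]) (simp add: field_simps)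
  also have "\<dots> = q_kernel q m (Suc n) * (1 - q ^ m)"
    using Suc by (simp add: kernel_Suc)
  finally show ?case .
qed

text \<open>In the variable \<open>m\<close>, summation followed by division by \<open>[m]\<close> has the columns of the kernel as
  eigenvectors, with eigenvalues \<open>1 / [n]\<close>. By induction on \<open>m\<close> this is the recurrence
  \<open>kernel_step_left\<close>.\<close>

lemma sum_kernel_left:
  assumes "q \<noteq> 0" "q \<noteq> 1" "0 < n" "\<And>i. 0 < i \<Longrightarrow> i \<le> n \<Longrightarrow> q ^ i \<noteq> 1"
  shows "(\<Sum>l\<in>{0<..<Suc m}. q_kernel q l n) = q_int q m * q_kernel q m n / q_int q n"
proof (induction m)
  case 0
  have "{0<..<Suc 0} = {}" by auto
  then show ?case by (simp add: q_int_def)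
next
  case (Suc m)
  have "{0<..<Suc (Suc m)} = insert (Suc m) {0<..<Suc m}" by auto
  then have "(\<Sum>l\<in>{0<..<Suc (Suc m)}. q_kernel q l n)
      = q_kernel q (Suc m) n + q_kernel q m n * (1 - q ^ m) / (1 - q ^ n)"
    using assms(2) by (simp add: Suc.IH) (simp add: q_int_def mult.commute)
  also have "q_kernel q m n * (1 - q ^ m) = q_kernel q (Suc m) n * (q ^ n - q ^ Suc m)"
    using kernel_step_left[OF assms(1,3)] assms(4) by simp
  also have "q_kernel q (Suc m) n + \<dots> / (1 - q ^ n) = q_int q (Suc m) * q_kernel q (Suc m) n / q_int q n"
  proof -
    \<comment> \<open>The denominator \<open>1 - q\<^sup>n\<close> is abstracted to an atom \<open>d\<close>, so that fractions can be cleared.\<close>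
    have "k + k * (1 - d - x) / d = (1 - x) * k / d" if "d \<noteq> 0" for k d x :: 'a
      using that by (simp add: field_simps)
    from this[of "1 - q ^ n"] show ?thesis
      using assms(2) assms(3) assms(4)[of n] by (simp add: q_int_def)
  qed
  finally show ?case .
qed

lemma kernel_step_right:
  assumes "q \<noteq> 0" "q \<noteq> 1" "0 < n" "q ^ n \<noteq> 1" "q ^ m \<noteq> 1"
  shows "q_kernel q m n * (q ^ n / q_int q n)
    = q ^ m / q_int q m * (q_kernel q m n - q_kernel q m (Suc n))"
proof -
  have "k - k * ((1 - (1 - d) / x) / d) = k * ((1 - d) / x * (1 - x) / d)"
    if "d \<noteq> 0" "x \<noteq> 0" for k d x :: 'a
    using that by (simp add: field_simps)
  from this[of "1 - q ^ n" "q ^ m"]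
  have "q_kernel q m n - q_kernel q m (Suc n)
      = q_kernel q m n * (q ^ n / q ^ m * (1 - q ^ m) / (1 - q ^ n))"
    using assms by (simp add: kernel_Suc)
  then show ?thesis
    using assms by (simp add: q_int_def)
qed

text \<open>The companion relation in the variable \<open>n\<close>: by \<open>kernel_step_right\<close> the summand is a difference
  of consecutive kernel entries, and the sum telescopes, because the kernel vanishes at \<open>N > m\<close>.\<close>

lemma sum_kernel_right:
  assumes "q \<noteq> 0" "\<And>i. 0 < i \<Longrightarrow> i < N \<Longrightarrow> q ^ i \<noteq> 1" "0 < m" "m < N" "0 < j" "j < N"
  shows "(\<Sum>n\<in>{j..<N}. q_kernel q m n * (q ^ n / q_int q n)) = q ^ m / q_int q m * q_kernel q m j"
proof -
  have "q \<noteq> 1" using assms(2)[of m] assms(3,4) by auto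
  have "(\<Sum>n\<in>{j..<N}. q_kernel q m n * (q ^ n / q_int q n))
      = q ^ m / q_int q m * (\<Sum>n\<in>{j..<N}. q_kernel q m n - q_kernel q m (Suc n))"
    unfolding sum_distrib_left
    using assms \<open>q \<noteq> 1\<close> by (intro sum.cong refl kernel_step_right) auto
  also have "(\<Sum>n\<in>{j..<N}. q_kernel q m n - q_kernel q m (Suc n)) = q_kernel q m j - q_kernel q m N"
    using sum_Suc_diff'[of j N "\<lambda>n. - q_kernel q m n"] assms(6) by simp
  finally show ?thesis
    using kernel_eq_0[of q m N] assms by simp
qed

text \<open>By \<open>sum_kernel_left\<close> the column sum is determined by the last row \<open>m = N - 1\<close>. There
  \<open>q\<^sup>-\<^sup>m = q\<close>, so the product defining the kernel becomes \<open>\<Prod> (1 - q\<^sup>i\<^sup>+\<^sup>1) / (1 - q\<^sup>i)\<close> and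
  telescopes to \<open>[n]\<close>.\<close>

lemma sum_kernel_root_of_unity:
  assumes q: "primitive_root_of_unity N q" and n: "0 < n" "n < N"
  shows "(\<Sum>m\<in>{0<..<N}. q_kernel q m n) = - 1"
proof -
  have nz: "q \<noteq> 0" by (rule primitive_root_nz[OF q])
  have ne: "q ^ i \<noteq> 1" if "0 < i" "i < N" for i
    using q that by (auto simp: primitive_root_of_unity_def)
  have "q \<noteq> 1" using ne[OF n] by auto
  have kernel_last: "q_kernel q (N - 1) k = q * q_int q k" if "0 < k" "k < N" for k
    using that
  proof (induction k rule: nat_induct_non_zero)
    case 1
    then show ?case
      using primitive_root_power_diff[OF q, of 1] \<open>q \<noteq> 1\<close> by (simp add: q_int_def)
  next
    case (Suc k)
    have "1 - q ^ k \<noteq> 0" using ne[of k] Suc by simp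
    then show ?case
      using Suc primitive_root_power_diff[OF q, of 1] \<open>q \<noteq> 1\<close>
      by (simp add: kernel_Suc q_int_def)
  qed
  have "Suc (N - 1) = N" using n by simp
  then have "(\<Sum>m\<in>{0<..<N}. q_kernel q m n) = q_int q (N - 1) * q_kernel q (N - 1) n / q_int q n"
    using sum_kernel_left[OF nz \<open>q \<noteq> 1\<close> n(1), of "N - 1"] ne n by simp
  then show ?thesis
    using kernel_last[OF n] primitive_root_power_diff[OF q, of 1] ne[OF n] nz \<open>q \<noteq> 1\<close> n
    by (simp add: q_int_def) (simp add: field_simps)
qed

section \<open>Duality\<close>

lemma sum_triangle_swap:
  "(\<Sum>n\<in>{0<..<N}. \<Sum>j\<in>{0<..<Suc n}. f n j) = (\<Sum>j\<in>{0<..<N}. \<Sum>n\<in>{j..<N}. f n (j::nat))"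
  unfolding sum.Sigma[OF finite_greaterThanLessThan ballI[OF finite_greaterThanLessThan]]
    sum.Sigma[OF finite_greaterThanLessThan ballI[OF finite_atLeastLessThan]]
  by (rule sum.reindex_bij_witness[where i = prod.swap and j = prod.swap]) auto

text \<open>The kernel intertwines the two ways of reading a word. A new letter \<^const>\<open>E0\<close> on the left is
  \<^const>\<open>E1\<close> on the right, where its summation is moved onto the kernel and evaluated by
  \<open>sum_kernel_right\<close>; for a letter \<^const>\<open>E1\<close> on the left, the summation is evaluated by
  \<open>sum_kernel_left\<close>. The final letter \<^const>\<open>E1\<close> is left alone by the Hoffman dual, and
  \<open>sum_kernel_right\<close> for the full range \<open>j = 1\<close> matches it with itself.\<close>

lemma word_sum_dual:
  assumes nz: "q \<noteq> 0" and ne: "\<And>i. 0 < i \<Longrightarrow> i < N \<Longrightarrow> q ^ i \<noteq> 1" and m: "0 < m" "m < N"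
  defines "F \<equiv> word_sum (\<lambda>m. q ^ m / q_int q m) (\<lambda>m. 1 / q_int q m)"
    and "G \<equiv> word_sum (\<lambda>m. 1 / q_int q m) (\<lambda>m. q ^ m / q_int q m)"
  shows "F (w @ [E1]) m = (\<Sum>n\<in>{0<..<N}. q_kernel q m n * G (tau w @ [E1]) n)"
  using m
proof (induction w arbitrary: m)
  case Nil
  have empty_word: "(\<Sum>l\<in>{0<..<Suc n}. of_bool (l = 1)) = (1 :: 'a)" if "0 < n" for n
    using that by (subst sum.remove[of _ 1]) auto
  have "(\<Sum>n\<in>{0<..<N}. q_kernel q m n * G (tau [] @ [E1]) n)
      = (\<Sum>n\<in>{1..<N}. q_kernel q m n * (q ^ n / q_int q n))"
    using empty_word by (intro sum.cong) (auto simp: G_def tau_def)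
  also have "\<dots> = F ([] @ [E1]) m"
    using sum_kernel_right[OF nz ne, where j = 1] Nil empty_word[of m] nz by (simp add: F_def)
  finally show ?case ..
next
  case (Cons x w)
  let ?G = "G (tau w @ [E1])"
  have "q \<noteq> 1" using ne[of m] Cons.prems by auto
  show ?case
  proof (cases x)
    case E0
    have "(\<Sum>n\<in>{0<..<N}. q_kernel q m n * G (tau (x # w) @ [E1]) n)
        = (\<Sum>n\<in>{0<..<N}. \<Sum>j\<in>{0<..<Suc n}. q_kernel q m n * (q ^ n / q_int q n) * ?G j)"
      by (simp add: E0 G_def tau_def sum_distrib_left mult.assoc)
    also have "\<dots> = (\<Sum>j\<in>{0<..<N}. (\<Sum>n\<in>{j..<N}. q_kernel q m n * (q ^ n / q_int q n)) * ?G j)"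
      by (simp add: sum_triangle_swap sum_distrib_right)
    also have "\<dots> = q ^ m / q_int q m * (\<Sum>j\<in>{0<..<N}. q_kernel q m j * ?G j)"
      using sum_kernel_right[OF nz ne Cons.prems]
      by (simp add: sum_distrib_left mult.assoc)
    also have "\<dots> = F ((x # w) @ [E1]) m"
      using Cons.IH[OF Cons.prems] by (simp add: E0 F_def)
    finally show ?thesis ..
  next
    case E1
    have "F ((x # w) @ [E1]) m = 1 / q_int q m * (\<Sum>l\<in>{0<..<Suc m}. F (w @ [E1]) l)"
      by (simp add: E1 F_def)
    also have "\<dots> = 1 / q_int q m * (\<Sum>l\<in>{0<..<Suc m}. \<Sum>n\<in>{0<..<N}. q_kernel q l n * ?G n)"
      using Cons.IH Cons.prems by simp
    also have "\<dots> = 1 / q_int q m * (\<Sum>n\<in>{0<..<N}. (\<Sum>l\<in>{0<..<Suc m}. q_kernel q l n) * ?G n)"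
      by (subst sum.swap) (simp add: sum_distrib_right)
    also have "\<dots> = (\<Sum>n\<in>{0<..<N}. q_kernel q m n * (1 / q_int q n * ?G n))"
      unfolding sum_distrib_left
    proof (intro sum.cong refl)
      fix n assume "n \<in> {0<..<N}"
      then have "(\<Sum>l\<in>{0<..<Suc m}. q_kernel q l n) = q_int q m * q_kernel q m n / q_int q n"
        using ne by (intro sum_kernel_left[OF nz \<open>q \<noteq> 1\<close>]) auto
      moreover have "q_int q m \<noteq> 0"
        using ne[OF Cons.prems] \<open>q \<noteq> 1\<close> by (simp add: q_int_def)
      ultimately show "1 / q_int q m * ((\<Sum>l\<in>{0<..<Suc m}. q_kernel q l n) * ?G n)
          = q_kernel q m n * (1 / q_int q n * ?G n)"
        by simp
    qed
    finally show ?thesis by (simp add: E1 G_def tau_def)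
  qed
qed

lemma length_index_word: "is_index ks \<Longrightarrow> length (index_word ks) = sum_list ks"
  by (induction ks) (auto simp: index_word_def is_index_def)

lemma index_word_butlast: "ks \<noteq> [] \<Longrightarrow> index_word ks = butlast (index_word ks) @ [E1]"
  by (cases ks rule: rev_cases) (simp_all add: index_word_def butlast_append)

lemma sum_list_hoffman_dual:
  assumes "is_index ks" "ks \<noteq> []"
  shows "sum_list (hoffman_dual ks) = sum_list ks"
proof -
  have "length (index_word (hoffman_dual ks)) = length (butlast (index_word ks) @ [E1])"
    by (simp add: hoffman_dual_spec(2) tau_def)
  also have "\<dots> = length (index_word ks)"
    using index_word_butlast[OF assms(2)] by simp
  finally show ?thesis
    using assms(1) hoffman_dual_spec(1) by (simp add: length_index_word)
qed

theorem z_star_duality: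
  assumes q: "primitive_root_of_unity n q" and n: "1 < n" and ks: "is_index ks" "ks \<noteq> []"
  shows "z_star n ks q = (- 1) ^ (sum_list ks + 1) * z_star n (rev (hoffman_dual ks)) q"
proof -
  define F where "F = word_sum (\<lambda>m. q ^ m / q_int q m) (\<lambda>m. 1 / q_int q m)"
  define G where "G = word_sum (\<lambda>m. 1 / q_int q m) (\<lambda>m. q ^ m / q_int q m)"
  define w where "w = butlast (index_word ks)"
  have words: "index_word ks = w @ [E1]" "index_word (hoffman_dual ks) = tau w @ [E1]"
    using index_word_butlast[OF ks(2)] by (simp_all add: w_def hoffman_dual_spec(2))
  have ne: "\<And>i. 0 < i \<Longrightarrow> i < n \<Longrightarrow> q ^ i \<noteq> 1"
    using q by (simp add: primitive_root_of_unity_def)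
  have "z_star n ks q = (\<Sum>m\<in>{0<..<n}. F (w @ [E1]) m)"
    by (simp add: z_star_eq_word_sum[OF n ks(1)] F_def words)
  also have "\<dots> = (\<Sum>m\<in>{0<..<n}. \<Sum>l\<in>{0<..<n}. q_kernel q m l * G (tau w @ [E1]) l)"
    using word_sum_dual[OF primitive_root_nz[OF q] ne] by (simp add: F_def G_def)
  also have "\<dots> = (\<Sum>l\<in>{0<..<n}. (\<Sum>m\<in>{0<..<n}. q_kernel q m l) * G (tau w @ [E1]) l)"
    by (subst sum.swap) (simp add: sum_distrib_right)
  also have "\<dots> = - (\<Sum>l\<in>{0<..<n}. G (tau w @ [E1]) l)"
    using sum_kernel_root_of_unity[OF q] by (simp add: sum_negf)
  also have "\<dots> = (- 1) ^ (sum_list ks + 1) * z_star n (rev (hoffman_dual ks)) q"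
    unfolding z_star_rev_eq_word_sum[OF q n hoffman_dual_spec(1)] words
      sum_list_hoffman_dual[OF ks] G_def
    by (simp flip: mult.assoc power_add mult_2)
  finally show ?thesis .
qed

section \<open>Transfer to \<open>\<A>\<^sup>c\<^sup>y\<^sup>c\<close>\<close>

lemma (in cring) minus_one_pow_mult:
  assumes "x \<in> carrier R"
  shows "(\<ominus> \<one>) [^] (n::nat) \<otimes> x = (if even n then x else \<ominus> x)"
proof -
  have "(\<ominus> \<one>) [^] n = (if even n then \<one> else \<ominus> \<one>)"
    by (induction n) (auto simp: l_minus)
  then show ?thesis using assms by (auto simp: l_minus)
qed

lemma (in ideal) rcos_zero: "I +> \<zero> = \<zero>\<^bsub>R Quot I\<^esub>"
  by (rule ring_hom_zero[OF rcos_ring_hom ring_axioms quotient_is_ring])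

lemma Z_star_cong:
  assumes "\<And>p. prime p \<Longrightarrow> z_star p ks (\<zeta> p) = z_star p ls (\<zeta> p)"
  shows "Z_star \<zeta> ks = Z_star \<zeta> ls"
proof -
  have "(\<lambda>p\<in>{p. prime p}. PIdl\<^bsub>int_adjoin (\<zeta> p)\<^esub> (of_nat p) +>\<^bsub>int_adjoin (\<zeta> p)\<^esub> z_star p ks (\<zeta> p))
    = (\<lambda>p\<in>{p. prime p}. PIdl\<^bsub>int_adjoin (\<zeta> p)\<^esub> (of_nat p) +>\<^bsub>int_adjoin (\<zeta> p)\<^esub> z_star p ls (\<zeta> p))"
    using assms by (intro restrict_ext) simp
  then show ?thesis unfolding Z_star_def by (rule arg_cong)
qed

text \<open>Stating the case of opposite values through a vanishing sum requires only that the coset maps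
  respect addition and zero; negation in the quotients never has to be computed.\<close>

lemma Z_star_add_eq_zero:
  assumes \<zeta>: "\<And>p. prime p \<Longrightarrow> primitive_root_of_unity p (\<zeta> p)"
    and sum0: "\<And>p. prime p \<Longrightarrow> z_star p ks (\<zeta> p) + z_star p ls (\<zeta> p) = 0"
  shows "Z_star \<zeta> ks \<oplus>\<^bsub>A_cyc \<zeta>\<^esub> Z_star \<zeta> ls = \<zero>\<^bsub>A_cyc \<zeta>\<^esub>"
proof -
  let ?I = "\<lambda>p. PIdl\<^bsub>int_adjoin (\<zeta> p)\<^esub> (of_nat p)"
  define f where "f xs = (\<lambda>p\<in>{p. prime p}. ?I p +>\<^bsub>int_adjoin (\<zeta> p)\<^esub> z_star p xs (\<zeta> p))" for xs
  have Z: "Z_star \<zeta> xs = A_sum \<zeta> +>\<^bsub>A_prod \<zeta>\<^esub> f xs" for xs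
    by (simp add: Z_star_def f_def)
  interpret S: ideal "A_sum \<zeta>" "A_prod \<zeta>"
    unfolding A_sum_def A_prod_def by (intro ideal_direct_sum_ideal cring_int_adjoin_mod)
  have "f xs \<in> carrier (A_prod \<zeta>)" for xs
    unfolding f_def A_prod_def product_ring_simps int_adjoin_mod_def
    by (intro restrict_PiE_iff[THEN iffD2] ballI coset_in_FactRing z_star_in_int_adjoin \<zeta>) auto
  then have "Z_star \<zeta> ks \<oplus>\<^bsub>A_cyc \<zeta>\<^esub> Z_star \<zeta> ls
      = A_sum \<zeta> +>\<^bsub>A_prod \<zeta>\<^esub> (f ks \<oplus>\<^bsub>A_prod \<zeta>\<^esub> f ls)"
    unfolding Z A_cyc_def using ring_hom_add[OF S.rcos_ring_hom] by metis
  also have "f ks \<oplus>\<^bsub>A_prod \<zeta>\<^esub> f ls = \<zero>\<^bsub>A_prod \<zeta>\<^esub>"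
    unfolding A_prod_def product_ring_simps
  proof (intro restrict_ext)
    fix p :: nat assume "p \<in> {p. prime p}"
    then have p: "prime p" by simp
    interpret J: ideal "?I p" "int_adjoin (\<zeta> p)" by (rule ideal_int_adjoin)
    note mem = z_star_in_int_adjoin[OF p \<zeta>[OF p]]
    have "f ks p \<oplus>\<^bsub>int_adjoin_mod (\<zeta> p) p\<^esub> f ls p
        = ?I p +>\<^bsub>int_adjoin (\<zeta> p)\<^esub> (z_star p ks (\<zeta> p) + z_star p ls (\<zeta> p))"
      using ring_hom_add[OF J.rcos_ring_hom mem mem, of ks ls] p
      by (simp add: f_def int_adjoin_mod_def)
    also have "\<dots> = \<zero>\<^bsub>int_adjoin_mod (\<zeta> p) p\<^esub>"
      using J.rcos_zero sum0[OF p]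
      by (simp add: int_adjoin_mod_def)
    finally show "f ks p \<oplus>\<^bsub>int_adjoin_mod (\<zeta> p) p\<^esub> f ls p = \<zero>\<^bsub>int_adjoin_mod (\<zeta> p) p\<^esub>" .
  qed
  also have "A_sum \<zeta> +>\<^bsub>A_prod \<zeta>\<^esub> \<zero>\<^bsub>A_prod \<zeta>\<^esub> = \<zero>\<^bsub>A_cyc \<zeta>\<^esub>"
    unfolding A_cyc_def by (rule S.rcos_zero)
  finally show ?thesis .
qed

theorem theorem3p7:
  fixes \<zeta> :: "nat \<Rightarrow> complex" and ks :: "nat list"
  assumes "\<And>p. prime p \<Longrightarrow> primitive_root_of_unity p (\<zeta> p)"
    and "ks \<noteq> []" and "is_index ks"
  shows "Z_star \<zeta> ks =
    (\<ominus>\<^bsub>A_cyc \<zeta>\<^esub> \<one>\<^bsub>A_cyc \<zeta>\<^esub>) [^]\<^bsub>A_cyc \<zeta>\<^esub> (sum_list ks + 1)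
      \<otimes>\<^bsub>A_cyc \<zeta>\<^esub> Z_star \<zeta> (rev (hoffman_dual ks))"
proof -
  interpret A: cring "A_cyc \<zeta>" by (rule cring_A_cyc)
  let ?ls = "rev (hoffman_dual ks)"
  have carr: "Z_star \<zeta> xs \<in> carrier (A_cyc \<zeta>)" for xs
    by (rule Z_star_in_carrier[OF assms(1)])
  have dual: "z_star p ks (\<zeta> p) = (- 1) ^ (sum_list ks + 1) * z_star p ?ls (\<zeta> p)"
    if "prime p" for p
    using that by (intro z_star_duality assms prime_gt_1_nat)
  show ?thesis
  proof (cases "even (sum_list ks + 1)")
    case True
    then have "Z_star \<zeta> ks = Z_star \<zeta> ?ls"
      using dual by (intro Z_star_cong) simp
    then show ?thesis
      unfolding A.minus_one_pow_mult[OF carr] using True by (simp only: if_True)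
  next
    case False
    then have "Z_star \<zeta> ks \<oplus>\<^bsub>A_cyc \<zeta>\<^esub> Z_star \<zeta> ?ls = \<zero>\<^bsub>A_cyc \<zeta>\<^esub>"
      by (intro Z_star_add_eq_zero assms(1))
        (simp_all only: dual neg_one_odd_power[OF False], simp)
    then have "Z_star \<zeta> ks = \<ominus>\<^bsub>A_cyc \<zeta>\<^esub> Z_star \<zeta> ?ls"
      using carr by (simp add: A.minus_equality)
    then show ?thesis
      unfolding A.minus_one_pow_mult[OF carr] using False by (simp only: if_False)
  qed
qed

end
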